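(* For every $k \in \mathbb{N}$ there exists a real number $\lambda_k \ge k^{-2k^2}$ with the following property: for every $k$-complex $\mathcal{S}$ there exists $n_0(\mathcal{S})$ such that for every $n \ge n_0(\mathcal{S})$, every $k$-complex on $n$ vertices with at least $n^{k+1-\lambda_k}$ facets contains a homeomorphic copy of $\mathcal{S}$.
   Context: All simplicial complexes are finite and homogeneous: a $k$-complex (a $k$-dimensional simplicial complex all of whose facets are $k$-dimensional) on a vertex set $V$ is specified by its family of facets, each a $(k+1)$-element subset of $V$; the complex consists of all subsets of its facets. A $k$-complex $\mathcal{T}$ contains a homeomorphic copy (homeomorph) of a $k$-complex $\mathcal{S}$ if some subcomplex of $\mathcal{T}$ is homeomorphic to $\mathcal{S}$ (as topological spaces, via geometric realizations).
   Formalization: Stated for k ≥ 2 only (vertices are taken in ℕ): for k = 1 the claim forces λ_1 ≥ 1 and fails, since the n-cycle has n ≥ n^{2−λ_1} facets but contains no homeomorph of the star K_{1,3}; k = 0 fails likewise with 0^0 = 1. *)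

theory Defs
  imports "HOL-Analysis.Analysis"
begin

definition k_complex :: "nat \<Rightarrow> 'a set \<Rightarrow> 'a set set \<Rightarrow> bool" where
  "k_complex k V F \<longleftrightarrow> finite V \<and> (\<forall>e\<in>F. e \<subseteq> V \<and> card e = k + 1)"

definition faces :: "'a set set \<Rightarrow> 'a set set" where
  "faces F = {s. \<exists>e\<in>F. s \<subseteq> e}"

text \<open>A subcomplex is any subfamily of the faces that is closed under taking subsets; it is
  not required to be homogeneous.\<close>

definition subcomplex :: "'a set set \<Rightarrow> 'a set set \<Rightarrow> bool" where
  "subcomplex L K \<longleftrightarrow> L \<subseteq> K \<and> (\<forall>s\<in>L. \<forall>t. t \<subseteq> s \<longrightarrow> t \<in> L)"

text \<open>Barycentric coordinates: a point is a convex combination of the vertices whose support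
  is a face. Functions carry the product topology, which for complexes with finitely many
  vertices induces the usual Euclidean topology. The empty face contributes no point,
  because the coordinates sum to 1.\<close>

definition realization :: "'a set set \<Rightarrow> ('a \<Rightarrow> real) set" where
  "realization K =
    {x. (\<forall>v. 0 \<le> x v) \<and> {v. x v \<noteq> 0} \<in> K \<and> (\<Sum>v | x v \<noteq> 0. x v) = 1}"

definition contains_homeomorph :: "'a set set \<Rightarrow> 'b set set \<Rightarrow> bool" where
  "contains_homeomorph T S \<longleftrightarrow>
    (\<exists>L. subcomplex L (faces T) \<and> realization L homeomorphic realization (faces S))"

text \<open>In the theorem, complexes live on finite sets of natural numbers; every finite complex
  has such a copy. The dimension \<open>k\<close> starts at 2, because the assertion is false for \<open>k = 1\<close>:
  there \<open>\<lambda> \<ge> 1\<close>, so the \<open>n\<close>-cycle has \<open>n \<ge> n powr (2 - \<lambda>)\<close> facets, but it contains no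
  homeomorph of the star with three edges. (In dimension 1 a constant factor depending on the
  forbidden complex is needed, as in Mader's theorem.) Likewise it is false for \<open>k = 0\<close>, with
  \<open>0\<^sup>0 = 1\<close>.\<close>

end

theory Submission
  imports Defs "HOL-Real_Asymp.Real_Asymp"
begin

text \<open>The homeomorph is found as a copy of the barycentric subdivision of \<open>S\<close>, whose facets are the
  full flags of faces. Its vertices are embedded dimension by dimension, by dependent random choice.
  Write \<open>T\<close> as a set of ordered \<open>r\<close>-tuples, \<open>r = k + 1\<close>, with the image of the largest face of a
  flag first. Pick \<open>t = 2\<^sup>r - 1\<close> random vertices and pass to the \<open>(r - 1)\<close>-tuples that extend by
  each of them to a tuple of \<open>T\<close>. If \<open>T\<close> has density \<open>\<delta>\<close>, this common link has expected density
  at least \<open>\<delta> ^ t\<close>, by convexity. The proper faces of an \<open>r\<close>-set have at most \<open>n ^ (2\<^sup>r - 2)\<close> placements,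
  and one with boundedly many common extensions survives with probability \<open>O(n ^ (- t))\<close>; as
  \<open>2\<^sup>r - 2 < t\<close>, some choice of the vertices kills all of these. By induction the lower-dimensional
  faces embed into the common link, and then every facet of \<open>S\<close> has so many candidates for its
  barycentre that distinct unused ones can be chosen greedily. Each dimension costs a factor
  \<open>2\<^sup>r > t\<close> in the exponent of the density, and \<open>2 ^ (- (1 + \<dots> + (k + 1))) \<ge> k ^ (- 2 k\<^sup>2)\<close>.\<close>

section \<open>Realizations of finite complexes\<close>

definition finite_complex :: "'a set set \<Rightarrow> bool" where
  "finite_complex K \<longleftrightarrow> finite (\<Union>K) \<and> (\<forall>s\<in>K. \<forall>t. t \<subseteq> s \<longrightarrow> t \<in> K)"

lemma finite_complex_imp_finite: "finite_complex K \<Longrightarrow> finite K"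
  unfolding finite_complex_def by (metis finite_UnionD)

lemma finite_complex_simplex_finite: "finite_complex K \<Longrightarrow> s \<in> K \<Longrightarrow> finite s"
  unfolding finite_complex_def by (meson Sup_upper finite_subset)

lemma finite_complex_subset_closed: "finite_complex K \<Longrightarrow> s \<in> K \<Longrightarrow> t \<subseteq> s \<Longrightarrow> t \<in> K"
  unfolding finite_complex_def by blast

lemma finite_complex_image:
  assumes "finite_complex K"
  shows "finite_complex ((`) \<phi> ` K)"
  unfolding finite_complex_def
proof (intro conjI ballI allI impI)
  show "finite (\<Union>((`) \<phi> ` K))"
    using assms by (simp add: finite_complex_def flip: image_Union)
next
  fix s t assume "s \<in> (`) \<phi> ` K" "t \<subseteq> s"
  then obtain c d where "c \<in> K" "d \<subseteq> c" "t = \<phi> ` d" by (auto simp: subset_image_iff)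
  then show "t \<in> (`) \<phi> ` K" using finite_complex_subset_closed[OF assms] by blast
qed

lemma sum_over_support:
  "finite A \<Longrightarrow> {v. x v \<noteq> 0} \<subseteq> A \<Longrightarrow> (\<Sum>v | x v \<noteq> 0. x v) = sum x A"
  by (rule sum.mono_neutral_left) auto

lemma compact_realization_Pow:
  fixes s :: "'a set"
  assumes "finite s"
  shows "compact (realization (Pow s))"
proof -
  let ?cube = "\<Pi>\<^sub>E v\<in>UNIV. if v \<in> s then {0..1} else {0::real}"
  have "compactin (product_topology (\<lambda>_. euclidean) UNIV) ?cube"
    unfolding compactin_PiE by auto
  then have "compact ?cube" by (simp add: euclidean_product_topology)
  moreover have "closed {x :: 'a \<Rightarrow> real. sum x s = 1}"
    by (intro closed_Collect_eq continuous_on_sum continuous_on_product_coordinates continuous_on_const)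
  moreover have "realization (Pow s) = ?cube \<inter> {x. sum x s = 1}"
  proof (intro subset_antisym subsetI)
    fix x assume x: "x \<in> realization (Pow s)"
    then have supp: "{v. x v \<noteq> 0} \<subseteq> s" and nonneg: "\<forall>v. 0 \<le> x v" by (auto simp: realization_def)
    have total: "sum x s = 1"
      using x sum_over_support[OF assms supp] by (simp add: realization_def)
    have "x v \<le> 1" if "v \<in> s" for v
      using member_le_sum[OF that, of x] nonneg assms total by simp
    then show "x \<in> ?cube \<inter> {x. sum x s = 1}" using total nonneg supp by auto
  next
    fix x assume x: "x \<in> ?cube \<inter> {x. sum x s = 1}"
    have coord: "x v \<in> (if v \<in> s then {0..1} else {0})" for v using x by blast
    have nonneg: "0 \<le> x v" and "v \<in> s \<or> x v = 0" for v
      using coord[of v] by (auto split: if_splits)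
    then have supp: "{v. x v \<noteq> 0} \<subseteq> s" by blast
    then have "(\<Sum>v | x v \<noteq> 0. x v) = 1" using x sum_over_support[OF assms supp] by simp
    then show "x \<in> realization (Pow s)" using nonneg supp by (simp add: realization_def)
  qed
  ultimately show ?thesis by (metis compact_Int_closed)
qed

lemma compact_realization:
  assumes "finite_complex K"
  shows "compact (realization K)"
proof -
  have "realization K = (\<Union>s\<in>K. realization (Pow s))"
    using finite_complex_subset_closed[OF assms] by (auto simp: realization_def)
  then show ?thesis
    using assms
    by (auto intro!: compact_UN compact_realization_Pow
        simp: finite_complex_imp_finite finite_complex_simplex_finite)
qed

definition pullback :: "'a set \<Rightarrow> ('a \<Rightarrow> 'b) \<Rightarrow> ('b \<Rightarrow> real) \<Rightarrow> 'a \<Rightarrow> real" where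
  "pullback A g x v = (if v \<in> A then x (g v) else 0)"

lemma continuous_on_pullback: "continuous_on S (pullback A g)"
proof (rule continuous_on_coordinatewise_then_product)
  fix v
  show "continuous_on S (\<lambda>x. pullback A g x v)"
    by (cases "v \<in> A")
      (auto simp: pullback_def intro: continuous_on_subset[OF continuous_on_product_coordinates])
qed

lemma pullback_in_realization:
  assumes "inj_on g A" "\<Union>K \<subseteq> g ` A" "x \<in> realization K"
  shows "pullback A g x \<in> realization {s. s \<subseteq> A \<and> g ` s \<in> K}"
proof -
  let ?supp = "{v\<in>A. x (g v) \<noteq> 0}"
  have "{u. x u \<noteq> 0} \<subseteq> g ` A" using assms(2,3) by (auto simp: realization_def)
  then have image: "g ` ?supp = {u. x u \<noteq> 0}" by auto
  have "sum (pullback A g x) ?supp = (\<Sum>v\<in>?supp. x (g v))"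
    by (intro sum.cong) (auto simp: pullback_def)
  also have "\<dots> = sum x (g ` ?supp)"
    using assms(1) by (subst sum.reindex) (auto intro: inj_on_subset)
  finally have "sum (pullback A g x) ?supp = 1"
    using assms(3) unfolding image by (simp add: realization_def)
  moreover have "{v. pullback A g x v \<noteq> 0} = ?supp" by (auto simp: pullback_def)
  ultimately show ?thesis
    using assms(3) image by (simp add: realization_def pullback_def)
qed

lemma pullback_inverse:
  assumes "x \<in> realization K" "\<Union>K \<subseteq> B" "\<And>u. u \<in> B \<Longrightarrow> h u \<in> A \<and> g (h u) = u"
  shows "pullback B h (pullback A g x) = x"
proof
  fix u
  have "x u = 0" if "u \<notin> B" using assms(1,2) that by (auto simp: realization_def)
  then show "pullback B h (pullback A g x) u = x u" using assms(3) by (auto simp: pullback_def)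
qed

lemma realization_image_homeomorphic:
  assumes inj: "inj_on \<phi> (\<Union>K)"
  shows "realization ((`) \<phi> ` K) homeomorphic realization K"
proof -
  let ?U = "\<phi> ` \<Union>K"
  define \<psi> where "\<psi> = the_inv_into (\<Union>K) \<phi>"
  have inj_\<psi>: "inj_on \<psi> ?U" unfolding \<psi>_def using inj by (rule inj_on_the_inv_into)
  have \<psi>: "\<psi> (\<phi> v) = v" if "v \<in> \<Union>K" for v
    using the_inv_into_f_f[OF inj that] by (simp add: \<psi>_def)
  then have \<phi>: "\<psi> u \<in> \<Union>K \<and> \<phi> (\<psi> u) = u" if "u \<in> ?U" for u using that by (elim imageE) simp
  have \<psi>_image: "\<psi> ` \<phi> ` c = c" if "c \<subseteq> \<Union>K" for c
    using that \<psi> by (auto simp: image_image subset_eq cong: image_cong_simp)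
  have pulled: "{s. s \<subseteq> \<Union>K \<and> \<phi> ` s \<in> (`) \<phi> ` K} = K"
    using inj_on_image_eq_iff[OF inj] by blast
  have pushed: "{s. s \<subseteq> ?U \<and> \<psi> ` s \<in> K} = (`) \<phi> ` K"
  proof (intro subset_antisym subsetI)
    fix s assume s: "s \<in> {s. s \<subseteq> ?U \<and> \<psi> ` s \<in> K}"
    then obtain c where "c \<subseteq> \<Union>K" "s = \<phi> ` c" by (blast elim: subset_imageE)
    then show "s \<in> (`) \<phi> ` K" using s \<psi>_image[of c] by simp
  next
    fix s assume "s \<in> (`) \<phi> ` K"
    then obtain c where c: "c \<in> K" "s = \<phi> ` c" by blast
    then have "c \<subseteq> \<Union>K" by blast
    then show "s \<in> {s. s \<subseteq> ?U \<and> \<psi> ` s \<in> K}" using c \<psi>_image[of c] by auto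
  qed
  have "homeomorphism (realization ((`) \<phi> ` K)) (realization K)
    (pullback (\<Union>K) \<phi>) (pullback ?U \<psi>)"
  proof (rule homeomorphismI)
    show "pullback (\<Union>K) \<phi> ` realization ((`) \<phi> ` K) \<subseteq> realization K"
      using pullback_in_realization[OF inj, of "(`) \<phi> ` K"] by (auto simp: pulled)
    show "pullback ?U \<psi> ` realization K \<subseteq> realization ((`) \<phi> ` K)"
      using pullback_in_realization[OF inj_\<psi>, of K] \<psi>_image by (auto simp: pushed)
    show "pullback ?U \<psi> (pullback (\<Union>K) \<phi> y) = y" if "y \<in> realization ((`) \<phi> ` K)" for y
      using that _ \<phi> by (rule pullback_inverse) auto
    show "pullback (\<Union>K) \<phi> (pullback ?U \<psi> x) = x" if "x \<in> realization K" for x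
      using that by (rule pullback_inverse) (simp_all add: \<psi>)
  qed (simp_all add: continuous_on_pullback)
  then show ?thesis unfolding homeomorphic_def by blast
qed

text \<open>Not an instance of \<open>homeomorphic_compact\<close>: function types are in class \<open>t2_space\<close> only for
  countable domains.\<close>

lemma homeomorphic_compact_function_space:
  fixes f :: "'a::topological_space \<Rightarrow> 'b \<Rightarrow> 'c::metric_space"
  assumes "compact S" "continuous_on S f" "inj_on f S"
  shows "S homeomorphic f ` S"
proof -
  have "Hausdorff_space (product_topology (\<lambda>_ :: 'b. euclidean :: 'c topology) UNIV)"
    by (simp add: Hausdorff_space_product_topology)
  then have "Hausdorff_space (euclidean :: ('b \<Rightarrow> 'c) topology)"
    by (simp only: euclidean_product_topology)
  then have "homeomorphic_map (top_of_set S) (top_of_set (f ` S)) f"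
    using assms by (intro continuous_imp_homeomorphic_map)
      (auto simp: compact_space_subtopology Hausdorff_space_subtopology)
  then obtain g where "homeomorphic_maps (top_of_set S) (top_of_set (f ` S)) f g"
    unfolding homeomorphic_map_maps by blast
  then have "homeomorphism S (f ` S) f g"
    by (auto intro!: homeomorphismI simp: homeomorphic_maps_def continuous_map_in_subtopology)
  then show ?thesis unfolding homeomorphic_def by blast
qed

section \<open>Barycentric subdivision\<close>

definition subdivision :: "'a set set \<Rightarrow> 'a set set set" where
  "subdivision K = {c. subset.chain (K - {{}}) c}"

lemma subdivision_subset: "c \<in> subdivision K \<Longrightarrow> c \<subseteq> K - {{}}"
  by (simp add: subdivision_def subset_chain_def)

lemma subdivision_subset_closed: "c \<in> subdivision K \<Longrightarrow> d \<subseteq> c \<Longrightarrow> d \<in> subdivision K"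
  by (simp add: subdivision_def subset_chain_def) (meson subset_iff)

lemma subdivision_mono: "K \<subseteq> L \<Longrightarrow> subdivision K \<subseteq> subdivision L"
  by (auto simp: subdivision_def subset_chain_def)

lemma Union_subdivision: "\<Union>(subdivision K) = K - {{}}"
proof (intro subset_antisym subsetI)
  fix s assume "s \<in> K - {{}}"
  then have "{s} \<in> subdivision K" by (auto simp: subdivision_def subset_chain_def)
  then show "s \<in> \<Union>(subdivision K)" by blast
qed (use subdivision_subset in blast)

lemma finite_complex_subdivision: "finite_complex K \<Longrightarrow> finite_complex (subdivision K)"
  using subdivision_subset_closed
  by (auto simp: finite_complex_def[of "subdivision K"] Union_subdivision finite_complex_imp_finite)

lemma Union_in_subdivision_simplex:
  assumes "finite_complex K" "c \<in> subdivision K" "c \<noteq> {}"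
  shows "\<Union>c \<in> c"
proof (rule Union_in_chain)
  show "finite c"
    using finite_complex_simplex_finite[OF finite_complex_subdivision[OF assms(1)] assms(2)] .
  show "subset.chain (K - {{}}) c" using assms(2) by (simp add: subdivision_def)
qed (rule assms(3))

lemma subdivision_Pow_misses_point:
  assumes "finite s" "s \<noteq> {}" "c \<in> subdivision (Pow s)" "s \<notin> c"
  shows "\<exists>v\<in>s. v \<notin> \<Union>c"
proof (cases "c = {}")
  case True
  then show ?thesis using assms(2) by auto
next
  case False
  have "finite_complex (Pow s)" using assms(1) by (auto simp: finite_complex_def)
  then have "\<Union>c \<in> c" using assms(3) False by (rule Union_in_subdivision_simplex)
  then have "\<Union>c \<subset> s" using assms(4) subdivision_subset[OF assms(3)] by blast
  then show ?thesis by blast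
qed

text \<open>A nonnegative function with finite support is a unique positive combination of indicators of
  the members of a chain of nonempty sets: the top of the chain is the support, and its coefficient
  is the minimum on the support.\<close>

definition chain_weights :: "'a set set \<Rightarrow> ('a set \<Rightarrow> real) set" where
  "chain_weights K = {z. (\<forall>f. 0 \<le> z f) \<and> {f. z f \<noteq> 0} \<in> subdivision K}"

definition chain_point :: "'a set set \<Rightarrow> ('a set \<Rightarrow> real) \<Rightarrow> 'a \<Rightarrow> real" where
  "chain_point K z v = (\<Sum>f\<in>K. z f * indicator f v)"

lemma chain_weights_nonneg: "z \<in> chain_weights K \<Longrightarrow> 0 \<le> z f"
  by (simp add: chain_weights_def)

lemma chain_weights_support: "z \<in> chain_weights K \<Longrightarrow> {f. z f \<noteq> 0} \<subseteq> K - {{}}"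
  by (simp add: chain_weights_def subdivision_subset)

lemma chain_weights_remove:
  assumes "z \<in> chain_weights K"
  shows "z(s := 0) \<in> chain_weights K"
proof -
  have "{f. (z(s := 0)) f \<noteq> 0} \<subseteq> {f. z f \<noteq> 0}" by auto
  then have "{f. (z(s := 0)) f \<noteq> 0} \<in> subdivision K"
    using assms subdivision_subset_closed unfolding chain_weights_def by blast
  then show ?thesis using assms by (simp add: chain_weights_def)
qed

lemma chain_weights_Pow_insert_top:
  assumes z: "z \<in> chain_weights (Pow t)" and "t \<subseteq> s" "s \<noteq> {}" "0 < m"
  shows "z(s := m) \<in> chain_weights (Pow s)"
proof -
  have "{f. z f \<noteq> 0} \<in> subdivision (Pow s)"
    using z subdivision_mono[OF Pow_mono[OF assms(2)]] by (auto simp: chain_weights_def)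
  moreover have "\<forall>f\<in>{f. z f \<noteq> 0}. f \<subseteq> s" using chain_weights_support[OF z] assms(2) by blast
  ultimately have "insert s {f. z f \<noteq> 0} \<in> subdivision (Pow s)"
    using assms(3) by (simp add: subdivision_def subset_chain_insert)
  moreover have "{f. (z(s := m)) f \<noteq> 0} = insert s {f. z f \<noteq> 0}" using assms(4) by auto
  ultimately show ?thesis
    using chain_weights_nonneg[OF z] assms(4) by (simp add: chain_weights_def)
qed

lemma chain_point_upd:
  assumes "finite K" "s \<in> K"
  shows "chain_point K (z(s := m)) v = chain_point K z v + (m - z s) * indicator s v"
proof -
  have "(\<Sum>f\<in>K - {s}. (z(s := m)) f * indicator f v) = (\<Sum>f\<in>K - {s}. z f * indicator f v)"
    by (intro sum.cong) auto
  then show ?thesis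
    unfolding chain_point_def using assms
    by (simp only: sum.remove[of K s] fun_upd_same) (simp add: algebra_simps)
qed

lemma chain_point_nonneg: "z \<in> chain_weights K \<Longrightarrow> 0 \<le> chain_point K z v"
  by (simp add: chain_point_def chain_weights_nonneg sum_nonneg)

lemma support_chain_point:
  assumes "finite K" "z \<in> chain_weights K"
  shows "{v. chain_point K z v \<noteq> 0} = \<Union>{f. z f \<noteq> 0}"
proof -
  have "chain_point K z v = 0 \<longleftrightarrow> (\<forall>f\<in>K. z f * indicator f v = 0)" for v
    unfolding chain_point_def using assms
    by (intro sum_nonneg_eq_0_iff) (auto simp: chain_weights_nonneg)
  then show ?thesis using chain_weights_support[OF assms(2)] by (force simp: indicator_def)
qed

lemma sum_chain_point:
  assumes K: "finite_complex K" and z: "z \<in> chain_weights K"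
  shows "(\<Sum>v | chain_point K z v \<noteq> 0. chain_point K z v) = (\<Sum>f\<in>K. real (card f) * z f)"
proof -
  have fin: "finite K" "finite (\<Union>K)"
    using K finite_complex_imp_finite by (auto simp: finite_complex_def)
  have "(\<Sum>v | chain_point K z v \<noteq> 0. chain_point K z v) = sum (chain_point K z) (\<Union>K)"
    using chain_weights_support[OF z] fin(2)
    by (intro sum_over_support) (auto simp: support_chain_point[OF fin(1) z])
  also have "\<dots> = (\<Sum>f\<in>K. \<Sum>v\<in>\<Union>K. z f * indicator f v)"
    unfolding chain_point_def by (rule sum.swap)
  also have "\<dots> = (\<Sum>f\<in>K. real (card f) * z f)"
  proof (rule sum.cong)
    fix f assume "f \<in> K"
    then have "(\<Sum>v\<in>\<Union>K. z f * indicator f v) = (\<Sum>v\<in>f. z f)"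
      using fin(2) by (intro sum.mono_neutral_cong_right) auto
    then show "(\<Sum>v\<in>\<Union>K. z f * indicator f v) = real (card f) * z f" by simp
  qed simp
  finally show ?thesis .
qed

lemma Min_chain_point:
  assumes K: "finite_complex K" and z: "z \<in> chain_weights K"
    and s: "s = \<Union>{f. z f \<noteq> 0}" "z s \<noteq> 0"
  shows "Min (chain_point K z ` s) = z s"
proof (rule Min_eqI)
  have sK: "s \<in> K - {{}}" using s(2) chain_weights_support[OF z] by blast
  then show "finite (chain_point K z ` s)" using finite_complex_simplex_finite[OF K] by blast
  have split: "chain_point K z v = z s * indicator s v + (\<Sum>f\<in>K - {s}. z f * indicator f v)" for v
    unfolding chain_point_def using finite_complex_imp_finite[OF K] sK by (intro sum.remove) auto
  show "z s \<le> y" if "y \<in> chain_point K z ` s" for y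
    using that by (auto simp: split sum_nonneg chain_weights_nonneg[OF z])
  have "{f. z f \<noteq> 0} - {s} \<in> subdivision (Pow s)"
    using z s(1) unfolding chain_weights_def subdivision_def subset_chain_def by blast
  then obtain v where v: "v \<in> s" "v \<notin> \<Union>({f. z f \<noteq> 0} - {s})"
    using subdivision_Pow_misses_point[of s] sK finite_complex_simplex_finite[OF K] by blast
  have "(\<Sum>f\<in>K - {s}. z f * indicator f v) = 0"
    using v(2) by (intro sum.neutral) (auto simp: indicator_def)
  then have "chain_point K z v = z s" using v(1) by (simp add: split)
  then show "z s \<in> chain_point K z ` s" using v(1) by force
qed

lemma chain_weights_top_neq_0:
  assumes K: "finite_complex K" and z: "z \<in> chain_weights K"
    and s: "s = \<Union>{f. z f \<noteq> 0}" "s \<noteq> {}"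
  shows "z s \<noteq> 0"
proof -
  have "{f. z f \<noteq> 0} \<noteq> {}" using s by auto
  then have "s \<in> {f. z f \<noteq> 0}"
    using z unfolding s(1) by (intro Union_in_subdivision_simplex[OF K]) (auto simp: chain_weights_def)
  then show ?thesis by simp
qed

lemma chain_point_eq_imp_top_eq:
  assumes K: "finite_complex K" and z: "z \<in> chain_weights K" and z': "z' \<in> chain_weights K"
    and eq: "chain_point K z = chain_point K z'" and s: "s = \<Union>{f. z f \<noteq> 0}" "s \<noteq> {}"
  shows "z s = z' s"
proof -
  have s': "s = \<Union>{f. z' f \<noteq> 0}"
    using eq z z' finite_complex_imp_finite[OF K] by (simp add: s(1) flip: support_chain_point)
  have "z s = Min (chain_point K z ` s)"
    using Min_chain_point[OF K z s(1) chain_weights_top_neq_0[OF K z s]] by simp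
  also have "\<dots> = z' s"
    unfolding eq using Min_chain_point[OF K z' s' chain_weights_top_neq_0[OF K z' s' s(2)]] .
  finally show ?thesis .
qed

lemma inj_on_chain_point:
  assumes K: "finite_complex K"
  shows "inj_on (chain_point K) (chain_weights K)"
proof (rule inj_onI)
  have fin: "finite K" using K by (rule finite_complex_imp_finite)
  have zero: "w f = 0" if "w \<in> chain_weights K" "\<Union>{f. w f \<noteq> 0} = {}" for w f
    using chain_weights_support[OF that(1)] that(2) by blast
  fix z z' :: "'a set \<Rightarrow> real"
  assume "z \<in> chain_weights K" "z' \<in> chain_weights K" "chain_point K z = chain_point K z'"
  then show "z = z'"
  proof (induction "card {f. z f \<noteq> 0}" arbitrary: z z' rule: less_induct)
    case less
    define s where "s = \<Union>{f. z f \<noteq> 0}"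
    show ?case
    proof (cases "s = {}")
      case True
      moreover have "s = \<Union>{f. z' f \<noteq> 0}"
        using less.prems fin by (simp add: s_def flip: support_chain_point)
      ultimately have empty: "\<Union>{f. z f \<noteq> 0} = {}" "\<Union>{f. z' f \<noteq> 0} = {}"
        using s_def by metis+
      show ?thesis
        using zero[OF less.prems(1) empty(1)] zero[OF less.prems(2) empty(2)] by (intro ext) simp
    next
      case False
      have top: "z s \<noteq> 0" using K less.prems(1) s_def False by (rule chain_weights_top_neq_0)
      have eq: "z s = z' s" using K less.prems s_def False by (rule chain_point_eq_imp_top_eq)
      have supp: "{f. z f \<noteq> 0} \<subseteq> K" using chain_weights_support[OF less.prems(1)] by blast
      then have sK: "s \<in> K" using top by blast
      have "z(s := 0) = z'(s := 0)"
      proof (rule less.hyps)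
        have "{f. (z(s := 0)) f \<noteq> 0} = {f. z f \<noteq> 0} - {s}" by auto
        moreover have "finite {f. z f \<noteq> 0}" using supp fin by (rule finite_subset)
        ultimately show "card {f. (z(s := 0)) f \<noteq> 0} < card {f. z f \<noteq> 0}"
          using top by (metis card_Diff1_less mem_Collect_eq)
        show "chain_point K (z(s := 0)) = chain_point K (z'(s := 0))"
          using less.prems(3) eq by (simp add: fun_eq_iff chain_point_upd[OF fin sK])
      qed (use less.prems in \<open>simp_all add: chain_weights_remove\<close>)
      then show ?thesis using eq by (metis fun_upd_triv fun_upd_upd)
    qed
  qed
qed

lemma subtract_minimum_on_support:
  fixes x :: "'a \<Rightarrow> real"
  assumes "\<And>v. 0 \<le> x v" "finite {v. x v \<noteq> 0}" "{v. x v \<noteq> 0} \<noteq> {}"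
  obtains m where "0 < m" "\<forall>v. 0 \<le> x v - m * indicator {v. x v \<noteq> 0} v"
    "{v. x v - m * indicator {v. x v \<noteq> 0} v \<noteq> 0} \<subset> {v. x v \<noteq> 0}"
proof -
  let ?s = "{v. x v \<noteq> 0}"
  define m where "m = Min (x ` ?s)"
  have "m \<in> x ` ?s" unfolding m_def using assms(2,3) by (intro Min_in) auto
  then obtain w where w: "x w = m" "x w \<noteq> 0" by blast
  have "m \<le> x v" if "x v \<noteq> 0" for v unfolding m_def using assms(2) that by (intro Min_le) auto
  then have "\<forall>v. 0 \<le> x v - m * indicator ?s v" by (simp add: indicator_def)
  moreover have "{v. x v - m * indicator ?s v \<noteq> 0} \<subseteq> ?s - {w}"
    using w by (auto simp: indicator_def)
  then have "{v. x v - m * indicator ?s v \<noteq> 0} \<subset> ?s" using w(2) by blast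
  moreover have "0 < m" using w assms(1)[of w] by simp
  ultimately show ?thesis by (intro that)
qed

lemma chain_point_surj:
  assumes K: "finite_complex K"
    and x: "\<And>v. 0 \<le> x v" "{v. x v \<noteq> 0} \<in> K"
  shows "\<exists>z\<in>chain_weights (Pow {v. x v \<noteq> 0}). chain_point K z = x"
  using x
proof (induction "card {v. x v \<noteq> 0}" arbitrary: x rule: less_induct)
  case less
  let ?s = "{v. x v \<noteq> 0}"
  have fin: "finite K" "finite ?s"
    using finite_complex_imp_finite[OF K] finite_complex_simplex_finite[OF K less.prems(2)] .
  show ?case
  proof (cases "?s = {}")
    case True
    then show ?thesis
      by (intro bexI[of _ "\<lambda>_. 0"])
        (auto simp: chain_weights_def subdivision_def subset_chain_def chain_point_def fun_eq_iff)
  next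
    case False
    obtain m where m: "0 < m" "\<forall>v. 0 \<le> x v - m * indicator ?s v"
      "{v. x v - m * indicator ?s v \<noteq> 0} \<subset> ?s"
      using subtract_minimum_on_support[OF less.prems(1) fin(2) False] .
    define x' where "x' v = x v - m * indicator ?s v" for v
    have x': "0 \<le> x' v" for v using m(2) by (simp add: x'_def)
    have supp: "{v. x' v \<noteq> 0} \<subset> ?s"
      using m(3) by (simp add: x'_def)
    have "card {v. x' v \<noteq> 0} < card ?s" using fin(2) supp by (rule psubset_card_mono)
    moreover have "{v. x' v \<noteq> 0} \<in> K"
      using K less.prems(2) psubset_imp_subset[OF supp] by (rule finite_complex_subset_closed)
    ultimately have "\<exists>z\<in>chain_weights (Pow {v. x' v \<noteq> 0}). chain_point K z = x'"
      using x' by (intro less.hyps)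
    then obtain z where z: "z \<in> chain_weights (Pow {v. x' v \<noteq> 0})" "chain_point K z = x'"
      by blast
    have "z(?s := m) \<in> chain_weights (Pow ?s)"
      using z(1) psubset_imp_subset[OF supp] False m(1) by (rule chain_weights_Pow_insert_top)
    moreover have "z ?s = 0" using chain_weights_support[OF z(1)] supp by blast
    then have "chain_point K (z(?s := m)) = x"
      using z(2) by (simp add: chain_point_upd[OF fin(1) less.prems(2)] x'_def fun_eq_iff)
    ultimately show ?thesis by blast
  qed
qed

text \<open>The barycentre of a nonempty face \<open>f\<close> is the indicator of \<open>f\<close> divided by \<open>card f\<close>.\<close>

definition barycentric_map :: "'a set set \<Rightarrow> ('a set \<Rightarrow> real) \<Rightarrow> 'a \<Rightarrow> real" where
  "barycentric_map K y = chain_point K (\<lambda>f. y f / card f)"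

lemma continuous_on_barycentric_map: "continuous_on A (barycentric_map K)"
proof -
  have "continuous_on UNIV (\<lambda>y. y f / card f * indicator f v :: real)" for f :: "'a set" and v
    by (cases "card f = 0") (auto intro!: continuous_intros)
  then have "continuous_on UNIV (barycentric_map K)"
    unfolding barycentric_map_def[abs_def] chain_point_def[abs_def]
    by (intro continuous_on_coordinatewise_then_product continuous_on_sum)
  then show ?thesis by (rule continuous_on_subset) simp
qed

lemma realization_subdivision_iff:
  assumes K: "finite_complex K"
  shows "y \<in> realization (subdivision K) \<longleftrightarrow>
    y \<in> chain_weights K \<and> sum y K = 1"
proof -
  have "(\<Sum>f | y f \<noteq> 0. y f) = sum y K" if "{f. y f \<noteq> 0} \<in> subdivision K"
    using sum_over_support[OF finite_complex_imp_finite[OF K], of y] subdivision_subset[OF that] by blast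
  then show ?thesis by (auto simp: realization_def chain_weights_def)
qed

lemma card_eq_0_imp_chain_weight_eq_0:
  assumes "finite_complex K" "z \<in> chain_weights K" "card f = 0"
  shows "z f = 0"
proof (rule ccontr)
  assume "z f \<noteq> 0"
  then have "f \<in> K - {{}}" using chain_weights_support[OF assms(2)] by blast
  then show False using finite_complex_simplex_finite[OF assms(1)] assms(3) by auto
qed

lemma chain_weights_rescale:
  assumes K: "finite_complex K" and z: "z \<in> chain_weights K"
    and r: "\<And>f. 0 \<le> r f" "\<And>f. card f \<noteq> 0 \<Longrightarrow> r f \<noteq> 0"
  shows "(\<lambda>f. r f * z f) \<in> chain_weights K"
proof -
  have "{f. r f * z f \<noteq> 0} = {f. z f \<noteq> 0}"
    using r(2) card_eq_0_imp_chain_weight_eq_0[OF K z] by auto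
  then show ?thesis using z r(1) by (simp add: chain_weights_def)
qed

lemma inj_on_barycentric_map:
  assumes K: "finite_complex K"
  shows "inj_on (barycentric_map K) (realization (subdivision K))"
proof (rule inj_onI)
  fix y y' :: "'a set \<Rightarrow> real"
  assume "y \<in> realization (subdivision K)" "y' \<in> realization (subdivision K)"
    and eq: "barycentric_map K y = barycentric_map K y'"
  then have y: "y \<in> chain_weights K" "y' \<in> chain_weights K"
    by (simp_all add: realization_subdivision_iff[OF K])
  have "(\<lambda>f. y f / card f) = (\<lambda>f. y' f / card f)"
    using inj_on_chain_point[OF K] eq y
      chain_weights_rescale[OF K, where r = "\<lambda>f. 1 / card f"]
    by (auto simp: barycentric_map_def dest!: inj_onD)
  then have "y f / card f = y' f / card f" for f by meson
  then have "y f = y' f" for f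
    using y[THEN card_eq_0_imp_chain_weight_eq_0[OF K]] by (metis divide_cancel_right of_nat_eq_0_iff)
  then show "y = y'" by (rule ext)
qed

lemma image_barycentric_map_subset:
  assumes K: "finite_complex K"
  shows "barycentric_map K ` realization (subdivision K) \<subseteq> realization K"
proof
  fix x assume "x \<in> barycentric_map K ` realization (subdivision K)"
  then obtain y where y: "y \<in> chain_weights K" "sum y K = 1" and x: "x = barycentric_map K y"
    by (auto simp: realization_subdivision_iff[OF K])
  define z where "z = (\<lambda>f. y f / card f)"
  have z: "z \<in> chain_weights K" and x_z: "x = chain_point K z"
    using chain_weights_rescale[OF K y(1), of "\<lambda>f. 1 / card f"]
    by (simp_all add: z_def x barycentric_map_def)
  have "card f * z f = y f" for f
    using card_eq_0_imp_chain_weight_eq_0[OF K y(1)] by (simp add: z_def)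
  then have sum: "(\<Sum>f\<in>K. card f * z f) = 1" using y(2) by simp
  have "{f. z f \<noteq> 0} \<noteq> {}"
  proof
    assume "{f. z f \<noteq> 0} = {}"
    then have "z f = 0" for f by blast
    then show False using sum by simp
  qed
  then have "\<Union>{f. z f \<noteq> 0} \<in> {f. z f \<noteq> 0}"
    using z by (intro Union_in_subdivision_simplex[OF K]) (auto simp: chain_weights_def)
  then have "{v. x v \<noteq> 0} \<in> K"
    using chain_weights_support[OF z] support_chain_point[OF finite_complex_imp_finite[OF K] z]
    by (auto simp: x_z)
  then show "x \<in> realization K"
    using sum sum_chain_point[OF K z] chain_point_nonneg[OF z] by (simp add: x_z realization_def)
qed

lemma realization_subset_image_barycentric_map:
  assumes K: "finite_complex K"
  shows "realization K \<subseteq> barycentric_map K ` realization (subdivision K)"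
proof
  fix x assume "x \<in> realization K"
  then have x: "\<And>v. 0 \<le> x v" "{v. x v \<noteq> 0} \<in> K" "(\<Sum>v | x v \<noteq> 0. x v) = 1"
    by (auto simp: realization_def)
  then obtain z where "z \<in> chain_weights (Pow {v. x v \<noteq> 0})" and x_z: "chain_point K z = x"
    using chain_point_surj[OF K] by blast
  moreover have "Pow {v. x v \<noteq> 0} \<subseteq> K"
    using finite_complex_subset_closed[OF K x(2)] by blast
  ultimately have z: "z \<in> chain_weights K"
    using subdivision_mono by (auto simp: chain_weights_def)
  define y where "y = (\<lambda>f. card f * z f)"
  have "y \<in> realization (subdivision K)"
    unfolding realization_subdivision_iff[OF K] y_def
    using chain_weights_rescale[OF K z] sum_chain_point[OF K z] x(3) by (simp add: x_z)
  moreover have "y f / card f = z f" for f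
    using card_eq_0_imp_chain_weight_eq_0[OF K z] by (simp add: y_def)
  then have "barycentric_map K y = x" by (simp add: barycentric_map_def x_z)
  ultimately show "x \<in> barycentric_map K ` realization (subdivision K)" by blast
qed

theorem realization_subdivision_homeomorphic:
  assumes "finite_complex K"
  shows "realization (subdivision K) homeomorphic realization K"
proof -
  have "compact (realization (subdivision K))"
    using assms by (intro compact_realization finite_complex_subdivision)
  then have "realization (subdivision K) homeomorphic barycentric_map K ` realization (subdivision K)"
    using continuous_on_barycentric_map inj_on_barycentric_map[OF assms]
    by (rule homeomorphic_compact_function_space)
  also have "barycentric_map K ` realization (subdivision K) = realization K"
    using image_barycentric_map_subset[OF assms] realization_subset_image_barycentric_map[OF assms]
    by (rule subset_antisym)
  finally show ?thesis .
qed

section \<open>Flags and their embeddings\<close>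

definition tuples :: "nat \<Rightarrow> 'a set \<Rightarrow> 'a list set" where
  "tuples t A = {xs. set xs \<subseteq> A \<and> length xs = t}"

lemma finite_tuples: "finite A \<Longrightarrow> finite (tuples t A)"
  unfolding tuples_def by (rule finite_lists_length_eq)

lemma card_tuples: "finite A \<Longrightarrow> card (tuples t A) = card A ^ t"
  unfolding tuples_def by (rule card_lists_length_eq)

primrec flag :: "nat \<Rightarrow> 'a set \<Rightarrow> 'a set list \<Rightarrow> bool" where
  "flag 0 A xs \<longleftrightarrow> xs = []"
| "flag (Suc r) A xs \<longleftrightarrow> (\<exists>f ys. xs = f # ys \<and> f \<subseteq> A \<and> card f = Suc r \<and> flag r f ys)"

definition nonempty_subsets_upto :: "nat \<Rightarrow> 'a set \<Rightarrow> 'a set set" where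
  "nonempty_subsets_upto r A = {f. f \<subseteq> A \<and> f \<noteq> {} \<and> card f \<le> r}"

lemma flag_mono: "flag r A xs \<Longrightarrow> A \<subseteq> B \<Longrightarrow> flag r B xs"
  by (cases r) auto

lemma set_flag_subset: "flag r A xs \<Longrightarrow> set xs \<subseteq> nonempty_subsets_upto r A"
proof (induction r arbitrary: A xs)
  case (Suc r)
  then obtain f ys where f: "xs = f # ys" "f \<subseteq> A" "card f = Suc r" "flag r f ys" by auto
  have "nonempty_subsets_upto r f \<subseteq> nonempty_subsets_upto (Suc r) A"
    using f(2) by (auto simp: nonempty_subsets_upto_def)
  moreover have "f \<in> nonempty_subsets_upto (Suc r) A"
    using f by (auto simp: nonempty_subsets_upto_def)
  ultimately show ?case using Suc.IH[OF f(4)] f(1) by auto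
qed simp

lemma subdivision_Pow_extends_to_flag:
  assumes "finite e" "card e = r" "c \<in> subdivision (Pow e)"
  shows "\<exists>xs. flag r e xs \<and> c \<subseteq> set xs"
  using assms
proof (induction r arbitrary: e c)
  case 0
  then have "c \<subseteq> {}" using subdivision_subset by fastforce
  then show ?case by simp
next
  case (Suc r)
  have "e \<noteq> {}" using Suc.prems(2) by auto
  moreover have rest: "c - {e} \<in> subdivision (Pow e)"
    using Suc.prems(3) by (rule subdivision_subset_closed) auto
  ultimately obtain v where v: "v \<in> e" "v \<notin> \<Union>(c - {e})"
    using subdivision_Pow_misses_point[OF Suc.prems(1), of "c - {e}"] by auto
  then have "c - {e} \<in> subdivision (Pow (e - {v}))"
    using rest subdivision_subset[OF rest] by (auto simp: subdivision_def subset_chain_def)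
  then have "\<exists>ys. flag r (e - {v}) ys \<and> c - {e} \<subseteq> set ys"
    using Suc.prems v(1) by (intro Suc.IH) auto
  then obtain ys where ys: "flag r (e - {v}) ys" "c - {e} \<subseteq> set ys" by blast
  have "flag (Suc r) e (e # ys)" using flag_mono[OF ys(1)] Suc.prems(2) by auto
  moreover have "c \<subseteq> set (e # ys)" using ys(2) by auto
  ultimately show ?case by blast
qed

definition flag_embedding :: "nat \<Rightarrow> 'a set \<Rightarrow> 'b set \<Rightarrow> 'b list set \<Rightarrow> ('a set \<Rightarrow> 'b) \<Rightarrow> bool" where
  "flag_embedding r V W G \<phi> \<longleftrightarrow>
     inj_on \<phi> (nonempty_subsets_upto r V) \<and>
     \<phi> ` nonempty_subsets_upto r V \<subseteq> W \<and>
     (\<forall>xs. flag r V xs \<longrightarrow> map \<phi> xs \<in> G)"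

definition apexes :: "nat \<Rightarrow> 'b set \<Rightarrow> 'b list set \<Rightarrow> ('a set \<Rightarrow> 'b) \<Rightarrow> 'a set \<Rightarrow> 'b set" where
  "apexes r W G \<phi> f = {w\<in>W. \<forall>xs. flag r f xs \<longrightarrow> w # map \<phi> xs \<in> G}"

lemma flag_embedding_0:
  assumes "finite V" "G \<subseteq> tuples 0 W" "G \<noteq> {}"
  shows "flag_embedding 0 V W G \<phi>"
proof -
  have "nonempty_subsets_upto 0 V = {}"
    using assms(1) finite_subset by (fastforce simp: nonempty_subsets_upto_def)
  moreover have "[] \<in> G" using assms(2,3) by (auto simp: tuples_def)
  ultimately show ?thesis by (simp add: flag_embedding_def)
qed

lemma distinct_representatives_avoiding:
  assumes "finite I" "finite B" "\<And>i. i \<in> I \<Longrightarrow> card I + card B \<le> card (A i)"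
  shows "\<exists>g. inj_on g I \<and> (\<forall>i\<in>I. g i \<in> A i - B)"
  using assms
proof (induction I arbitrary: B rule: finite_induct)
  case (insert i I)
  have "card B < card (A i)" using insert by force
  then obtain a where a: "a \<in> A i" "a \<notin> B"
    by (metis card_mono insert.prems(1) not_le subsetI)
  have "\<exists>g. inj_on g I \<and> (\<forall>j\<in>I. g j \<in> A j - insert a B)"
    using insert.prems insert.hyps a by (intro insert.IH) auto
  then obtain g where g: "inj_on g I" "\<forall>j\<in>I. g j \<in> A j - insert a B" by blast
  have "inj_on (g(i := a)) (insert i I)"
    using g insert.hyps by (auto simp: inj_on_def)
  moreover have "\<forall>j\<in>insert i I. (g(i := a)) j \<in> A j - B" using g a by auto
  ultimately show ?case by blast
qed auto

lemma nonempty_subsets_upto_Suc: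
  "nonempty_subsets_upto (Suc r) V = {f. f \<subseteq> V \<and> card f = Suc r} \<union> nonempty_subsets_upto r V"
  by (auto simp: nonempty_subsets_upto_def)

lemma flag_embedding_override_on:
  assumes \<phi>: "flag_embedding r V W H \<phi>"
    and I: "I = {f. f \<subseteq> V \<and> card f = Suc r}"
    and g: "inj_on g I" "\<And>f. f \<in> I \<Longrightarrow> g f \<in> apexes r W G \<phi> f - \<phi> ` nonempty_subsets_upto r V"
  shows "flag_embedding (Suc r) V W G (override_on \<phi> g I)"
  unfolding flag_embedding_def nonempty_subsets_upto_Suc I[symmetric]
proof (intro conjI allI impI)
  let ?J = "nonempty_subsets_upto r V"
  have disjoint: "I \<inter> ?J = {}" by (auto simp: I nonempty_subsets_upto_def)
  have on_J: "override_on \<phi> g I f = \<phi> f" if "f \<in> ?J" for f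
    using that disjoint by (intro override_on_apply_notin) blast
  have image: "override_on \<phi> g I ` I = g ` I" "override_on \<phi> g I ` ?J = \<phi> ` ?J"
    using on_J by (auto intro!: image_cong)
  have "inj_on (override_on \<phi> g I) I" using g(1) by (simp cong: inj_on_cong)
  moreover have "inj_on (override_on \<phi> g I) ?J"
    using \<phi> on_J by (simp add: flag_embedding_def cong: inj_on_cong)
  ultimately show "inj_on (override_on \<phi> g I) (I \<union> ?J)"
    using disjoint g(2) by (auto simp: inj_on_Un image Diff_triv)
  show "override_on \<phi> g I ` (I \<union> ?J) \<subseteq> W"
    using \<phi> g(2) by (auto simp: image_Un image flag_embedding_def apexes_def)
  fix xs assume "flag (Suc r) V xs"
  then obtain f ys where f: "xs = f # ys" "f \<in> I" "flag r f ys" by (auto simp: I)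
  have "set ys \<subseteq> ?J"
    using set_flag_subset[OF flag_mono[OF f(3)]] f(2) by (simp add: I)
  then have "map (override_on \<phi> g I) xs = g f # map \<phi> ys"
    using f(1,2) on_J by (simp add: subset_iff)
  also have "\<dots> \<in> G" using g(2)[OF f(2)] f(3) by (simp add: apexes_def)
  finally show "map (override_on \<phi> g I) xs \<in> G" .
qed

lemma flag_embedding_extend:
  assumes V: "finite V"
    and \<phi>: "flag_embedding r V W H \<phi>"
    and many: "\<And>f. f \<subseteq> V \<Longrightarrow> card f = Suc r \<Longrightarrow> 2 ^ Suc (card V) \<le> card (apexes r W G \<phi> f)"
  shows "\<exists>\<phi>'. flag_embedding (Suc r) V W G \<phi>'"
proof -
  define I where "I = {f. f \<subseteq> V \<and> card f = Suc r}"
  let ?J = "nonempty_subsets_upto r V"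
  have sub: "I \<subseteq> Pow V" "?J \<subseteq> Pow V" by (auto simp: I_def nonempty_subsets_upto_def)
  then have fin: "finite I" "finite ?J" using V by (auto intro: finite_subset)
  have "card I \<le> 2 ^ card V" "card ?J \<le> 2 ^ card V"
    using sub V card_mono[of "Pow V"] by (simp_all add: card_Pow)
  moreover have "card (\<phi> ` ?J) \<le> card ?J" using fin(2) by (rule card_image_le)
  ultimately have "card I + card (\<phi> ` ?J) \<le> 2 ^ Suc (card V)" by simp
  then have "\<exists>g. inj_on g I \<and> (\<forall>f\<in>I. g f \<in> apexes r W G \<phi> f - \<phi> ` ?J)"
    using fin many by (intro distinct_representatives_avoiding) (auto simp: I_def intro: order_trans)
  then show ?thesis using flag_embedding_override_on[OF \<phi> I_def] by blast
qed

section \<open>Dependent random choice\<close>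

lemma power_mean_le:
  fixes f :: "'a \<Rightarrow> real"
  assumes "finite A" "A \<noteq> {}" "\<And>x. x \<in> A \<Longrightarrow> 0 \<le> f x"
  shows "(sum f A / card A) ^ n \<le> (\<Sum>x\<in>A. f x ^ n) / card A"
proof -
  have "convex_on {0::real..} (\<lambda>x. x ^ n)"
    using convex_power_even[of n] convex_power_odd[of n]
    by (cases "even n") (auto intro: convex_on_subset)
  from convex_on_sum[OF assms(1,2) this, of "\<lambda>_. 1 / card A" f] assms
  show ?thesis by (simp add: sum_divide_distrib)
qed

definition common_link :: "nat \<Rightarrow> 'b set \<Rightarrow> 'b list set \<Rightarrow> 'b list \<Rightarrow> 'b list set" where
  "common_link r W G ws = {e\<in>tuples r W. \<forall>w\<in>set ws. w # e \<in> G}"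

lemma card_tuples_eq_sum_extensions:
  assumes "finite W" "G \<subseteq> tuples (Suc r) W"
  shows "card G = (\<Sum>e\<in>tuples r W. card {w\<in>W. w # e \<in> G})"
proof -
  let ?E = "SIGMA e:tuples r W. {w\<in>W. w # e \<in> G}"
  have "G = (\<lambda>(e, w). w # e) ` ?E"
  proof (intro subset_antisym subsetI)
    fix xs assume xs: "xs \<in> G"
    then obtain w e where we: "xs = w # e" using assms(2) by (cases xs) (auto simp: tuples_def)
    then have "w \<in> W" "e \<in> tuples r W" using subsetD[OF assms(2) xs] by (auto simp: tuples_def)
    then show "xs \<in> (\<lambda>(e, w). w # e) ` ?E" using xs we by force
  qed auto
  then have "card G = card ((\<lambda>(e, w). w # e) ` ?E)" by (rule arg_cong)
  also have "\<dots> = card ?E" by (intro card_image) (auto simp: inj_on_def)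
  finally show ?thesis using assms(1) by (simp add: finite_tuples card_SigmaI)
qed

lemma sum_card_common_link:
  assumes "finite W"
  shows "(\<Sum>ws\<in>tuples t W. card (common_link r W G ws)) =
    (\<Sum>e\<in>tuples r W. card {w\<in>W. w # e \<in> G} ^ t)"
proof -
  have "{ws\<in>tuples t W. \<forall>w\<in>set ws. w # e \<in> G} = tuples t {w\<in>W. w # e \<in> G}" for e
    by (auto simp: tuples_def)
  then show ?thesis
    unfolding common_link_def using assms
    by (intro sum_multicount_gen) (simp_all add: finite_tuples card_tuples)
qed

lemma sum_card_common_link_ge:
  fixes d :: real
  assumes W: "finite W" "W \<noteq> {}" and G: "G \<subseteq> tuples (Suc r) W"
    and d: "0 \<le> d" "d * real (card W) ^ Suc r \<le> card G"
  shows "d ^ t * real (card W) ^ (r + t) \<le> (\<Sum>ws\<in>tuples t W. real (card (common_link r W G ws)))"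
proof -
  let ?n = "real (card W)" and ?ext = "\<lambda>e. real (card {w\<in>W. w # e \<in> G})"
  have n: "0 < ?n" using W by (simp add: card_gt_0_iff)
  have tuples: "finite (tuples r W)" "real (card (tuples r W)) = ?n ^ r"
    using W by (simp_all add: finite_tuples card_tuples)
  then have "tuples r W \<noteq> {}" using n by auto
  have "d * ?n = d * ?n ^ Suc r / ?n ^ r" using n by simp
  also have "\<dots> \<le> real (card G) / ?n ^ r" using d(2) by (intro divide_right_mono) auto
  also have "real (card G) = sum ?ext (tuples r W)"
    using card_tuples_eq_sum_extensions[OF W(1) G] by simp
  finally have "(d * ?n) ^ t \<le> (sum ?ext (tuples r W) / ?n ^ r) ^ t"
    using d(1) by (intro power_mono) auto
  also have "\<dots> \<le> (\<Sum>e\<in>tuples r W. ?ext e ^ t) / ?n ^ r"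
    using power_mean_le[OF tuples(1) \<open>tuples r W \<noteq> {}\<close>, of ?ext t] by (simp add: tuples(2))
  also have "(\<Sum>e\<in>tuples r W. ?ext e ^ t) = real (\<Sum>ws\<in>tuples t W. card (common_link r W G ws))"
    unfolding sum_card_common_link[OF W(1)] by simp
  finally show ?thesis
    using n by (simp add: pos_le_divide_eq power_mult_distrib power_add algebra_simps)
qed

lemma card_common_link_le:
  assumes "finite W"
  shows "card (common_link r W G ws) \<le> card W ^ r"
  using card_mono[of "tuples r W" "common_link r W G ws"] assms
  by (auto simp: common_link_def finite_tuples card_tuples)

lemma sum_card_containing_le:
  assumes "finite W" "finite B" "\<And>b. b \<in> B \<Longrightarrow> D b \<subseteq> W \<and> card (D b) \<le> M"
  shows "(\<Sum>ws\<in>tuples t W. card {b\<in>B. set ws \<subseteq> D b}) \<le> card B * M ^ t"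
proof -
  have "(\<Sum>ws\<in>tuples t W. card {b\<in>B. set ws \<subseteq> D b}) = (\<Sum>b\<in>B. card (D b) ^ t)"
  proof (rule sum_multicount_gen[OF finite_tuples[OF assms(1)] assms(2)], rule ballI)
    fix b assume b: "b \<in> B"
    then have "{ws\<in>tuples t W. set ws \<subseteq> D b} = tuples t (D b)"
      using assms(3) by (fastforce simp: tuples_def)
    then show "card {ws\<in>tuples t W. set ws \<subseteq> D b} = card (D b) ^ t"
      using assms(1,3) b by (metis card_tuples finite_subset)
  qed
  also have "\<dots> \<le> (\<Sum>b\<in>B. M ^ t)" using assms(3) by (intro sum_mono power_mono) auto
  finally show ?thesis by simp
qed

lemma sum_le_imp_ex_le:
  fixes f g :: "'a \<Rightarrow> real"
  assumes "finite A" "A \<noteq> {}" "sum f A \<le> sum g A"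
  shows "\<exists>x\<in>A. f x \<le> g x"
  using assms sum_strict_mono[of A g f] by (meson not_le)

lemma dependent_random_choice:
  fixes d q :: real
  assumes W: "finite W" "W \<noteq> {}" and G: "G \<subseteq> tuples (Suc r) W"
    and d: "0 \<le> d" "d * real (card W) ^ Suc r \<le> card G"
    and B: "finite B" "\<And>b. b \<in> B \<Longrightarrow> D b \<subseteq> W \<and> card (D b) \<le> M"
    and q: "0 < q" "q * real (card W) ^ t + real (card W) ^ r * (card B * real M ^ t)
      \<le> d ^ t * real (card W) ^ (r + t)"
  obtains ws where "ws \<in> tuples t W" "q \<le> card (common_link r W G ws)" "\<forall>b\<in>B. \<not> set ws \<subseteq> D b"
proof -
  let ?n = "real (card W)"
  define link where "link ws = real (card (common_link r W G ws))" for ws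
  define bad where "bad ws = card {b\<in>B. set ws \<subseteq> D b}" for ws
  have tuples: "finite (tuples m W)" "card (tuples m W) = card W ^ m" for m
    using W(1) by (simp_all add: finite_tuples card_tuples)
  have "real (\<Sum>ws\<in>tuples t W. bad ws) \<le> real (card B * M ^ t)"
    unfolding bad_def using sum_card_containing_le[OF W(1) B] by (rule of_nat_mono)
  then have bad_le: "(\<Sum>ws\<in>tuples t W. real (bad ws)) \<le> card B * real M ^ t" by simp
  have "(\<Sum>ws\<in>tuples t W. q) \<le> d ^ t * ?n ^ (r + t) - ?n ^ r * (card B * real M ^ t)"
    using q(2) by (simp add: tuples mult.commute)
  also have "\<dots> \<le> (\<Sum>ws\<in>tuples t W. link ws) - ?n ^ r * (\<Sum>ws\<in>tuples t W. real (bad ws))"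
    unfolding link_def
    by (intro diff_mono sum_card_common_link_ge[OF W G d] mult_left_mono[OF bad_le]) auto
  also have "\<dots> = (\<Sum>ws\<in>tuples t W. link ws - ?n ^ r * real (bad ws))"
    by (simp add: sum_subtractf sum_distrib_left)
  finally have average:
    "(\<Sum>ws\<in>tuples t W. q) \<le> (\<Sum>ws\<in>tuples t W. link ws - ?n ^ r * real (bad ws))" .
  have "card (tuples t W) \<noteq> 0" using W by (simp add: tuples)
  then have "tuples t W \<noteq> {}" by auto
  then obtain ws where ws: "ws \<in> tuples t W" "q \<le> link ws - ?n ^ r * real (bad ws)"
    using sum_le_imp_ex_le[OF tuples(1) _ average] by blast
  \<comment> \<open>A single bad set costs \<open>n ^ r\<close>, which no link can pay for.\<close>
  have link_le: "link ws \<le> ?n ^ r"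
    unfolding link_def of_nat_power[symmetric] using card_common_link_le[OF W(1)] by (rule of_nat_mono)
  have "bad ws = 0"
  proof (rule ccontr)
    assume "bad ws \<noteq> 0"
    then have "?n ^ r * 1 \<le> ?n ^ r * real (bad ws)" by (intro mult_left_mono) auto
    then show False using ws(2) link_le q(1) by linarith
  qed
  then have "\<forall>b\<in>B. \<not> set ws \<subseteq> D b" using B(1) by (auto simp: bad_def)
  moreover have "q \<le> card (common_link r W G ws)" using ws(2) \<open>bad ws = 0\<close> by (simp add: link_def)
  ultimately show ?thesis using that[OF ws(1)] by blast
qed

section \<open>Flag embeddings into dense families of tuples\<close>

lemma nonempty_subsets_upto_eq_proper_subsets:
  assumes "finite f" "card f = Suc r"
  shows "nonempty_subsets_upto r f = Pow f - {{}, f}"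
proof (intro subset_antisym subsetI)
  fix g assume g: "g \<in> Pow f - {{}, f}"
  then have "card g < card f" using assms(1) by (intro psubset_card_mono) auto
  then show "g \<in> nonempty_subsets_upto r f" using g assms(2) by (simp add: nonempty_subsets_upto_def)
qed (use assms(2) in \<open>auto simp: nonempty_subsets_upto_def\<close>)

lemma card_nonempty_subsets_upto:
  assumes "card f = Suc r"
  shows "card (nonempty_subsets_upto r f) = 2 ^ Suc r - 2"
proof -
  have f: "finite f" "f \<noteq> {}" using assms by (auto intro: card_ge_0_finite)
  then show ?thesis
    unfolding nonempty_subsets_upto_eq_proper_subsets[OF f(1) assms]
    using assms by (subst card_Diff_subset) (auto simp: card_Pow)
qed

definition placements :: "nat \<Rightarrow> 'a set \<Rightarrow> 'b set \<Rightarrow> ('a set \<times> ('a set \<Rightarrow> 'b)) set" where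
  "placements r V W = (SIGMA f:{f. f \<subseteq> V \<and> card f = Suc r}. nonempty_subsets_upto r f \<rightarrow>\<^sub>E W)"

lemma
  fixes V :: "'a set" and W :: "'b set"
  assumes V: "finite V" and W: "finite W"
  shows finite_placements: "finite (placements r V W)"
    and card_placements_le: "card (placements r V W) \<le> 2 ^ card V * card W ^ (2 ^ Suc r - 2)"
proof -
  let ?I = "{f. f \<subseteq> V \<and> card f = Suc r}"
  have I: "finite ?I" "card ?I \<le> 2 ^ card V"
    using V card_mono[of "Pow V" ?I] by (auto simp: card_Pow intro: finite_subset[of _ "Pow V"])
  have "nonempty_subsets_upto r f \<subseteq> Pow V" if "f \<in> ?I" for f
    using that by (auto simp: nonempty_subsets_upto_def)
  then have fin: "finite (nonempty_subsets_upto r f)" if "f \<in> ?I" for f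
    using V that by (meson finite_Pow_iff finite_subset)
  show "finite (placements r V W)"
    unfolding placements_def using I(1) fin W by (intro finite_SigmaI finite_PiE) auto
  have "card (placements r V W) = (\<Sum>f\<in>?I. card (nonempty_subsets_upto r f \<rightarrow>\<^sub>E W))"
    unfolding placements_def using I(1) fin W by (intro card_SigmaI) (auto intro: finite_PiE)
  also have "\<dots> = (\<Sum>f\<in>?I. card W ^ (2 ^ Suc r - 2))"
    using fin by (intro sum.cong) (auto simp: card_funcsetE card_nonempty_subsets_upto)
  finally show "card (placements r V W) \<le> 2 ^ card V * card W ^ (2 ^ Suc r - 2)"
    using I(2) by simp
qed

lemma set_subset_apexes_common_link:
  assumes "flag_embedding r V W (common_link r W G ws) \<phi>" "f \<subseteq> V" "set ws \<subseteq> W"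
  shows "set ws \<subseteq> apexes r W G \<phi> f"
proof -
  have "map \<phi> xs \<in> common_link r W G ws" if "flag r f xs" for xs
    using assms(1) flag_mono[OF that assms(2)] by (simp add: flag_embedding_def)
  then show ?thesis using assms(3) by (auto simp: apexes_def common_link_def)
qed

lemma restrict_in_placements:
  assumes "flag_embedding r V W H \<phi>" "f \<subseteq> V" "card f = Suc r"
  shows "(f, restrict \<phi> (nonempty_subsets_upto r f)) \<in> placements r V W"
proof -
  have "nonempty_subsets_upto r f \<subseteq> nonempty_subsets_upto r V"
    using assms(2) by (auto simp: nonempty_subsets_upto_def)
  then show ?thesis using assms by (auto simp: placements_def flag_embedding_def)
qed

lemma apexes_restrict: "apexes r W G (restrict \<phi> (nonempty_subsets_upto r f)) f = apexes r W G \<phi> f"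
proof -
  have "map (restrict \<phi> (nonempty_subsets_upto r f)) xs = map \<phi> xs" if "flag r f xs" for xs
    using set_flag_subset[OF that] by (intro map_cong) auto
  then show ?thesis by (simp add: apexes_def del: map_eq_conv cong: imp_cong)
qed

lemma flag_embedding_step:
  fixes V :: "'a set" and W :: "'b set" and r :: nat and d q :: real
  defines "t \<equiv> 2 ^ Suc r - 1" and "M \<equiv> 2 ^ Suc (card V)"
  assumes V: "finite V" and W: "finite W" "W \<noteq> {}" and G: "G \<subseteq> tuples (Suc r) W"
    and d: "0 \<le> d" "d * real (card W) ^ Suc r \<le> card G"
    and q: "0 < q" "q * real (card W) ^ t
        + real (card W) ^ r * (2 ^ card V * real (card W) ^ (t - 1) * real M ^ t)
      \<le> d ^ t * real (card W) ^ (r + t)"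
    and embed: "\<And>H. H \<subseteq> tuples r W \<Longrightarrow> q \<le> card H \<Longrightarrow> \<exists>\<phi> :: 'a set \<Rightarrow> 'b. flag_embedding r V W H \<phi>"
  shows "\<exists>\<phi> :: 'a set \<Rightarrow> 'b. flag_embedding (Suc r) V W G \<phi>"
proof -
  let ?n = "real (card W)"
  define D where "D p = apexes r W G (snd p) (fst p)" for p :: "'a set \<times> ('a set \<Rightarrow> 'b)"
  define B where "B = {p \<in> placements r V W. card (D p) \<le> M}"
  have fin: "finite B" using finite_placements[OF V W(1)] by (simp add: B_def)
  have small: "D p \<subseteq> W \<and> card (D p) \<le> M" if "p \<in> B" for p
    using that by (auto simp: B_def D_def apexes_def)
  have "card B \<le> 2 ^ card V * card W ^ (t - 1)"
    using card_mono[of "placements r V W" B] finite_placements[OF V W(1)]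
      card_placements_le[OF V W(1), of r] by (auto simp: B_def t_def numeral_2_eq_2)
  then have "real (card B) \<le> real (2 ^ card V * card W ^ (t - 1))" by (rule of_nat_mono)
  then have "real (card B) \<le> 2 ^ card V * ?n ^ (t - 1)" by simp
  then have "?n ^ r * (card B * real M ^ t) \<le> ?n ^ r * (2 ^ card V * ?n ^ (t - 1) * real M ^ t)"
    by (intro mult_left_mono mult_right_mono) auto
  then have "q * ?n ^ t + ?n ^ r * (card B * real M ^ t) \<le> d ^ t * ?n ^ (r + t)"
    using q(2) by linarith
  with W G d fin small q(1) obtain ws where ws: "ws \<in> tuples t W" "q \<le> card (common_link r W G ws)"
    "\<forall>p\<in>B. \<not> set ws \<subseteq> D p"
    by (rule dependent_random_choice)
  obtain \<phi> :: "'a set \<Rightarrow> 'b" where \<phi>: "flag_embedding r V W (common_link r W G ws) \<phi>"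
    using embed[OF _ ws(2)] by (auto simp: common_link_def)
  show ?thesis
  proof (rule flag_embedding_extend[OF V \<phi>])
    fix f assume f: "f \<subseteq> V" "card f = Suc r"
    let ?p = "(f, restrict \<phi> (nonempty_subsets_upto r f))"
    have D: "D ?p = apexes r W G \<phi> f" by (simp add: D_def apexes_restrict)
    have "set ws \<subseteq> D ?p"
      unfolding D using \<phi> f(1) ws(1) by (intro set_subset_apexes_common_link) (auto simp: tuples_def)
    then have "?p \<notin> B" using ws(3) by blast
    then show "2 ^ Suc (card V) \<le> card (apexes r W G \<phi> f)"
      using restrict_in_placements[OF \<phi> f] by (simp add: B_def D M_def)
  qed
qed

definition flag_exponent :: "nat \<Rightarrow> real" where
  "flag_exponent r = (1 / 2) ^ (Suc r choose 2)"

lemma flag_exponent_pos: "0 < flag_exponent r"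
  by (simp add: flag_exponent_def)

lemma flag_exponent_le_1: "flag_exponent r \<le> 1"
  by (simp add: flag_exponent_def power_le_one)

lemma flag_exponent_Suc: "flag_exponent (Suc r) * 2 ^ Suc r = flag_exponent r"
proof -
  have "Suc (Suc r) choose 2 = Suc r + (Suc r choose 2)" by (simp add: numeral_2_eq_2)
  then show ?thesis by (simp add: flag_exponent_def power_add power_one_over)
qed

lemma eventually_link_density_le:
  fixes a b C :: real
  assumes "b * t < a" "a \<le> 1" "0 < t"
  shows "\<forall>\<^sub>F n in sequentially. real n powr (real r - a) * real n ^ t + real n ^ r * (C * real n ^ (t - 1))
    \<le> (real n powr (- b)) ^ t * real n ^ (r + t)"
proof -
  define c where "c = b * t"
  have c: "c < a" "c < 1" using assms(1,2) by (simp_all add: c_def)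
  have "\<forall>\<^sub>F n::nat in sequentially. n powr (- a) \<le> n powr (- c) / 2" using c(1) by real_asymp
  moreover have "\<forall>\<^sub>F n::nat in sequentially. C / n \<le> n powr (- c) / 2" using c(2) by real_asymp
  ultimately show ?thesis
    using eventually_gt_at_top[of 0]
  proof eventually_elim
    case (elim n)
    have "real n ^ t = real n * real n ^ (t - 1)" using assms(3) by (cases t) auto
    moreover have "real n powr (real r - a) = real n ^ r * real n powr (- a)"
      using elim(3) by (simp add: powr_realpow[symmetric] powr_add[symmetric])
    ultimately have "real n powr (real r - a) * real n ^ t + real n ^ r * (C * real n ^ (t - 1))
        = real n ^ (r + t) * (n powr (- a) + C / n)"
      using elim(3) by (simp add: power_add field_simps)
    also have "\<dots> \<le> real n ^ (r + t) * n powr (- c)"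
      using add_mono[OF elim(1,2)] by (intro mult_left_mono) auto
    also have "\<dots> = (real n powr (- b)) ^ t * real n ^ (r + t)"
      using elim(3) by (simp add: c_def powr_power mult.commute)
    finally show ?case .
  qed
qed

lemma eventually_flag_density_le:
  fixes r :: nat and C :: real
  defines "t \<equiv> 2 ^ Suc r - 1"
  shows "\<forall>\<^sub>F n in sequentially.
    real n powr (real r - flag_exponent r) * real n ^ t + real n ^ r * (C * real n ^ (t - 1))
    \<le> (real n powr (- flag_exponent (Suc r))) ^ t * real n ^ (r + t)"
proof (rule eventually_link_density_le)
  show "flag_exponent (Suc r) * t < flag_exponent r"
    using flag_exponent_Suc[of r] flag_exponent_pos[of "Suc r"]
    by (simp add: t_def of_nat_diff algebra_simps)
  show "0 < t" using one_less_power[of "2::nat" "Suc r"] by (simp add: t_def)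
qed (rule flag_exponent_le_1)

theorem dense_tuples_contain_flag_embedding:
  fixes V :: "'a set"
  assumes V: "finite V"
  shows "\<forall>\<^sub>F n in sequentially. \<forall>(W :: 'b set) G. finite W \<longrightarrow> card W = n \<longrightarrow> G \<subseteq> tuples r W \<longrightarrow>
    real n powr (real r - flag_exponent r) \<le> card G \<longrightarrow> (\<exists>\<phi>. flag_embedding r V W G \<phi>)"
proof (induction r)
  case 0
  show ?case
    using eventually_gt_at_top[of 0]
  proof eventually_elim
    case (elim n)
    then have "0 < real n powr (real 0 - flag_exponent 0)" by simp
    then have "G \<noteq> {}" if "real n powr (real 0 - flag_exponent 0) \<le> card G" for G :: "'b list set"
      using that by auto
    then show ?case using flag_embedding_0[OF V] by blast
  qed
next
  case (Suc r)
  show ?case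
    using eventually_flag_density_le[of r "2 ^ card V * real (2 ^ Suc (card V)) ^ (2 ^ Suc r - 1)"]
      Suc.IH eventually_gt_at_top[of 0]
  proof eventually_elim
    case (elim n)
    show ?case
    proof (intro allI impI)
      fix W :: "'b set" and G
      assume W: "finite W" "card W = n" and G: "G \<subseteq> tuples (Suc r) W"
        "real n powr (real (Suc r) - flag_exponent (Suc r)) \<le> card G"
      have "W \<noteq> {}" using W(2) elim(3) by auto
      moreover have "real n powr (- flag_exponent (Suc r)) * real n ^ Suc r \<le> card G"
        using G(2) elim(3) by (simp add: powr_realpow[symmetric] powr_add[symmetric] del: power_Suc)
      moreover have "0 < real n powr (real r - flag_exponent r)" using elim(3) by simp
      ultimately show "\<exists>\<phi>. flag_embedding (Suc r) V W G \<phi>"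
        using elim(1,2) W G(1)
        by (intro flag_embedding_step[OF V, where d = "real n powr (- flag_exponent (Suc r))"
              and q = "real n powr (real r - flag_exponent r)"]) (auto simp: mult_ac)
    qed
  qed
qed

section \<open>Homeomorphs in dense complexes\<close>

lemma k_complex_imp_finite_complex:
  assumes "k_complex k V S"
  shows "finite_complex (faces S)"
proof -
  have "finite V" "\<Union>(faces S) \<subseteq> V" using assms by (auto simp: k_complex_def faces_def)
  then show ?thesis
    by (auto simp: finite_complex_def finite_subset) (auto simp: faces_def)
qed

lemma contains_homeomorph_if_subdivision_embeds:
  assumes S: "finite_complex (faces S)" and inj: "inj_on \<phi> (faces S - {{}})"
    and faces: "\<And>c. c \<in> subdivision (faces S) \<Longrightarrow> \<phi> ` c \<in> faces T"
  shows "contains_homeomorph T S"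
proof -
  let ?L = "(`) \<phi> ` subdivision (faces S)"
  have "realization ?L homeomorphic realization (subdivision (faces S))"
    using inj by (intro realization_image_homeomorphic) (simp add: Union_subdivision)
  also have "\<dots> homeomorphic realization (faces S)"
    using S by (rule realization_subdivision_homeomorphic)
  finally have "realization ?L homeomorphic realization (faces S)" .
  moreover have "finite_complex ?L" using S by (intro finite_complex_image finite_complex_subdivision)
  then have "subcomplex ?L (faces T)"
    unfolding subcomplex_def finite_complex_def using faces by blast
  ultimately show ?thesis unfolding contains_homeomorph_def by blast
qed

definition orderings :: "'a set set \<Rightarrow> 'a list set" where
  "orderings T = {xs. distinct xs \<and> set xs \<in> T}"

lemma orderings_subset_tuples:
  assumes "k_complex k W T"
  shows "orderings T \<subseteq> tuples (Suc k) W"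
  using assms by (force simp: k_complex_def orderings_def tuples_def distinct_card[symmetric])

lemma card_le_card_orderings:
  assumes "k_complex k W T"
  shows "card T \<le> card (orderings T)"
proof (rule surj_card_le)
  have "finite W" using assms by (simp add: k_complex_def)
  then show "finite (orderings T)"
    using orderings_subset_tuples[OF assms] finite_tuples finite_subset by blast
  show "T \<subseteq> set ` orderings T"
  proof
    fix e assume e: "e \<in> T"
    then have "finite e" using assms finite_subset by (auto simp: k_complex_def)
    then obtain xs where "set xs = e" "distinct xs" using finite_distinct_list by blast
    then show "e \<in> set ` orderings T" using e by (auto simp: orderings_def)
  qed
qed

lemma flag_embedding_imp_contains_homeomorph:
  assumes S: "k_complex k V S" and T: "T \<noteq> {}"
    and \<phi>: "flag_embedding (Suc k) V W (orderings T) \<phi>"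
  shows "contains_homeomorph T S"
proof (rule contains_homeomorph_if_subdivision_embeds)
  have V: "finite V" and facet: "\<And>e. e \<in> S \<Longrightarrow> e \<subseteq> V \<and> card e = Suc k"
    using S by (auto simp: k_complex_def)
  show complex: "finite_complex (faces S)" using S by (rule k_complex_imp_finite_complex)
  have "f \<in> nonempty_subsets_upto (Suc k) V" if "f \<in> faces S - {{}}" for f
  proof -
    obtain e where e: "e \<in> S" "f \<subseteq> e" using \<open>f \<in> faces S - {{}}\<close> by (auto simp: faces_def)
    then have "card f \<le> card e" using facet[OF e(1)] V by (meson card_mono finite_subset)
    then show ?thesis using facet[OF e(1)] e(2) that by (auto simp: nonempty_subsets_upto_def)
  qed
  then show "inj_on \<phi> (faces S - {{}})"
    using \<phi> unfolding flag_embedding_def by (meson inj_on_subset subsetI)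
  fix c assume c: "c \<in> subdivision (faces S)"
  show "\<phi> ` c \<in> faces T"
  proof (cases "c = {}")
    case True
    then show ?thesis using T by (auto simp: faces_def)
  next
    case False
    then have "\<Union>c \<in> faces S"
      using Union_in_subdivision_simplex[OF complex c] subdivision_subset[OF c] by blast
    then obtain e where e: "e \<in> S" "\<Union>c \<subseteq> e" by (auto simp: faces_def)
    then have "c \<in> subdivision (Pow e)" using c by (auto simp: subdivision_def subset_chain_def)
    then obtain xs where xs: "flag (Suc k) e xs" "c \<subseteq> set xs"
      using subdivision_Pow_extends_to_flag facet[OF e(1)] finite_subset[OF _ V] by metis
    have "flag (Suc k) V xs" using flag_mono[OF xs(1)] facet[OF e(1)] by blast
    then have "set (map \<phi> xs) \<in> T" using \<phi> unfolding flag_embedding_def orderings_def by blast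
    moreover have "\<phi> ` c \<subseteq> set (map \<phi> xs)" using xs(2) by auto
    ultimately show ?thesis unfolding faces_def by blast
  qed
qed

theorem dense_complex_contains_homeomorph:
  fixes V :: "'a set"
  assumes S: "k_complex k V S"
  shows "\<forall>\<^sub>F n in sequentially. \<forall>(W :: 'b set) T. k_complex k W T \<longrightarrow> card W = n \<longrightarrow>
    real n powr (real k + 1 - flag_exponent (Suc k)) \<le> card T \<longrightarrow> contains_homeomorph T S"
proof -
  have "finite V" using S by (simp add: k_complex_def)
  from dense_tuples_contain_flag_embedding[OF this, of "Suc k", where 'b = 'b]
  show ?thesis
    using eventually_gt_at_top[of 0]
  proof eventually_elim
    case (elim n)
    show ?case
    proof (intro allI impI)
      fix W :: "'b set" and T
      assume T: "k_complex k W T" "card W = n"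
        and dense: "real n powr (real k + 1 - flag_exponent (Suc k)) \<le> card T"
      have "0 < real n powr (real k + 1 - flag_exponent (Suc k))" using elim(2) by simp
      then have "T \<noteq> {}" using dense by auto
      have "real n powr (real (Suc k) - flag_exponent (Suc k)) \<le> card (orderings T)"
        using dense card_le_card_orderings[OF T(1)] by (simp add: add.commute)
      moreover have "finite W" using T(1) by (simp add: k_complex_def)
      ultimately obtain \<phi> where "flag_embedding (Suc k) V W (orderings T) \<phi>"
        using elim(1) T(2) orderings_subset_tuples[OF T(1)] by blast
      with S \<open>T \<noteq> {}\<close> show "contains_homeomorph T S"
        by (rule flag_embedding_imp_contains_homeomorph)
    qed
  qed
qed

lemma flag_exponent_ge:
  assumes "2 \<le> k"
  shows "real k powr (- 2 * real k ^ 2) \<le> flag_exponent (Suc k)"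
proof -
  have "Suc (Suc k) choose 2 \<le> 2 * k\<^sup>2"
  proof -
    have "(k + 2) * (k + 1) \<le> (2 * k) * (2 * k)" using assms by (intro mult_mono) auto
    then show ?thesis by (simp add: choose_two power2_eq_square)
  qed
  have "real k powr (- 2 * real k ^ 2) = 1 / real k powr real (2 * k\<^sup>2)"
    by (simp add: powr_minus_divide)
  also have "\<dots> = (1 / real k) ^ (2 * k\<^sup>2)"
    using assms by (subst powr_realpow) (simp_all add: power_one_over)
  also have "\<dots> \<le> (1 / 2) ^ (2 * k\<^sup>2)" using assms by (intro power_mono) auto
  also have "\<dots> \<le> flag_exponent (Suc k)"
    unfolding flag_exponent_def using \<open>Suc (Suc k) choose 2 \<le> 2 * k\<^sup>2\<close>
    by (intro power_decreasing) auto
  finally show ?thesis .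
qed

theorem theorem1p1:
  fixes k :: nat
  assumes "k \<ge> 2"
  shows "\<exists>lam::real. lam \<ge> real k powr (- 2 * real k ^ 2) \<and>
    (\<forall>(V :: nat set) S. k_complex k V S \<longrightarrow>
      (\<exists>n\<^sub>0::nat. \<forall>n\<ge>n\<^sub>0. \<forall>(W :: nat set) T.
        k_complex k W T \<longrightarrow> card W = n \<longrightarrow>
        real (card T) \<ge> real n powr (real k + 1 - lam) \<longrightarrow>
        contains_homeomorph T S))"
proof (intro exI[of _ "flag_exponent (Suc k)"] conjI allI impI)
  show "real k powr (- 2 * real k ^ 2) \<le> flag_exponent (Suc k)"
    using assms by (rule flag_exponent_ge)
next
  fix V :: "nat set" and S
  assume "k_complex k V S"
  then show "\<exists>n\<^sub>0. \<forall>n\<ge>n\<^sub>0. \<forall>(W :: nat set) T. k_complex k W T \<longrightarrow> card W = n \<longrightarrow>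
      real n powr (real k + 1 - flag_exponent (Suc k)) \<le> real (card T) \<longrightarrow> contains_homeomorph T S"
    using dense_complex_contains_homeomorph by (simp add: eventually_sequentially)
qed

end
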